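(* For every $\epsilon>0$ there is a two-dimensional continued fraction expansion $\mu_\epsilon$ having the following property: for all $x$ in some dense subset of $\mathbb R^2$ consisting of rank 3 points, the sequence $\mu_\epsilon(x)=E_{\epsilon 0},E_{\epsilon 1},\dots$ satisfies $$\lim_{n\to\infty}\frac{\max_{i=1,2,3}\operatorname{dist}(x,v_{ni})}{(2d_{\epsilon n1}d_{\epsilon n2}d_{\epsilon n3})^{-1/2}}\ \leq\ \lim_{n\to\infty}\frac{\operatorname{diam}(E_{\epsilon n})}{\operatorname{area}(E_{\epsilon n})^{1/2}}\ <\ 2\cdot\left(\frac13\right)^{1/4}+\epsilon,$$ where $v_{ni}=(p_{\epsilon ni}/d_{\epsilon ni},q_{\epsilon ni}/d_{\epsilon ni})$ is the $i$th vertex of the triangle $E_{\epsilon n}$ ($i=1,2,3$).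
   Context: A two-dimensional continued fraction expansion is a map $\mu$ assigning to every $x\in\mathbb R^2\setminus\mathbb Q^2$ a sequence $\mu(x)=T_0,T_1,\dots$ of triangles $T_n\subseteq\mathbb R^2$ with rational vertices $(p_{ni}/d_{ni},q_{ni}/d_{ni})$, where $p_{ni},q_{ni},d_{ni}\in\mathbb Z$, $d_{ni}>0$, $i=1,2,3$, such that $\bigcap_n T_n=\{x\}$ and, for every $n$, the $3\times3$ integer matrix with rows $(p_{ni},q_{ni},d_{ni})$, $i=1,2,3$, has determinant $\pm1$. (For $\mu_\epsilon$ the integers $p_{\epsilon ni},q_{\epsilon ni},d_{\epsilon ni}$ play the role of $p_{ni},q_{ni},d_{ni}$.) A point $x=(x_1,x_2)\in\mathbb R^2$ is a rank 3 point if the subgroup $\mathbb Zx_1+\mathbb Zx_2+\mathbb Z$ of the additive group $\mathbb R$ has rank 3 (equivalently, $x_1,x_2,1$ are linearly independent over $\mathbb Q$). For a triangle $T$, $\operatorname{diam}(T)$ is the length of its longest side; $\operatorname{dist}$ is euclidean distance. *)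

theory Defs
  imports "HOL-Analysis.Analysis"
begin

definition rational_plane :: "(real^2) set" where
  "rational_plane = {x. \<forall>i. x $ i \<in> \<rat>}"

text \<open>A row \<open>(p, q, d)\<close> gives homogeneous coordinates of the rational point \<open>(p/d, q/d)\<close>.\<close>

definition rat_point :: "int^3 \<Rightarrow> real^2" where
  "rat_point r = vector [of_int (r $ 1) / of_int (r $ 3), of_int (r $ 2) / of_int (r $ 3)]"

text \<open>The determinant condition forces every row to be primitive, so \<open>T\<close> determines \<open>M\<close> up to
  the order of its rows; it also forces the triangle to be nondegenerate.\<close>

definition unimodular_triangle :: "int^3^3 \<Rightarrow> (real^2) set \<Rightarrow> bool" where
  "unimodular_triangle M T \<longleftrightarrow>
     (\<forall>i. M $ i $ 3 > 0) \<and> (det M = 1 \<or> det M = -1) \<and>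
     T = convex hull (range (\<lambda>i. rat_point (M $ i)))"

text \<open>Expansions are total functions; their values on rational points are irrelevant.\<close>

definition continued_fraction_expansion :: "(real^2 \<Rightarrow> nat \<Rightarrow> (real^2) set) \<Rightarrow> bool" where
  "continued_fraction_expansion \<mu> \<longleftrightarrow>
     (\<forall>x. x \<notin> rational_plane \<longrightarrow>
        (\<forall>n. \<exists>M. unimodular_triangle M (\<mu> x n)) \<and> (\<Inter>n. \<mu> x n) = {x})"

definition longest_side :: "int^3^3 \<Rightarrow> real" where
  "longest_side M = Max {dist (rat_point (M $ 1)) (rat_point (M $ 2)),
                         dist (rat_point (M $ 2)) (rat_point (M $ 3)),
                         dist (rat_point (M $ 3)) (rat_point (M $ 1))}"

definition int_independent :: "real set \<Rightarrow> bool" where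
  "int_independent B \<longleftrightarrow>
     finite B \<and> (\<forall>c::real \<Rightarrow> int. (\<Sum>b\<in>B. of_int (c b) * b) = 0 \<longrightarrow> (\<forall>b\<in>B. c b = 0))"

text \<open>The rank of a subgroup of the additive reals is the maximal size of an independent subset
  over the integers.\<close>

definition has_rank :: "real set \<Rightarrow> nat \<Rightarrow> bool" where
  "has_rank G r \<longleftrightarrow>
     (\<exists>B\<subseteq>G. int_independent B \<and> card B = r) \<and>
     (\<forall>B\<subseteq>G. int_independent B \<longrightarrow> card B \<le> r)"

definition rank3_point :: "real^2 \<Rightarrow> bool" where
  "rank3_point x \<longleftrightarrow>
     has_rank {of_int a * x $ 1 + of_int b * x $ 2 + of_int c | a b c :: int. True} 3"

end

(*
  A bounded pair of ratios has a convergent subsequence, so it suffices that every point of a dense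
  set of rank 3 points lies in arbitrarily small unimodular triangles T with
  diam T < c * sqrt(area T), where c exceeds the equilateral value 2 * (1/3)^(1/4) only slightly.
  By Baire's theorem the points with this property that lie on no rational line are dense, once
  nearly equilateral unimodular triangles occur in every open set.

  For the latter, project Z^3 along a primitive vector v = (i r, j s, 2 r s) to the plane. The image
  is the centred rectangular lattice with basis (1/s, 0), (1/(2s), 1/(2r)), which is nearly hexagonal
  when s/r is close to sqrt 3. Lifting the two basis vectors with huge third coordinates of ratio
  close to 1 gives a unimodular triangle at the rational point v whose shape is close to that of
  the lattice triangle.

  All other points are handled by resolving small rational triangles into unimodular ones.
*)

theory Submission
  imports Defs "HOL-Number_Theory.Cong" "HOL-Real_Asymp.Real_Asymp"
begin

section \<open>Metric invariants of unimodular triangles\<close>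

lemma rat_point_nth [simp]:
  "rat_point r $ 1 = of_int (r $ 1) / of_int (r $ 3)"
  "rat_point r $ 2 = of_int (r $ 2) / of_int (r $ 3)"
  by (simp_all add: rat_point_def)

lemma range_3: "range (f :: 3 \<Rightarrow> 'a) = {f 1, f 2, f 3}"
  by (simp add: UNIV_3)

lemma bounded_unimodular_triangle:
  assumes "unimodular_triangle M T"
  shows "bounded T"
proof -
  have "T = convex hull (range (\<lambda>i. rat_point (M $ i)))"
    using assms by (simp add: unimodular_triangle_def)
  then show ?thesis
    by (simp only:) (intro bounded_convex_hull finite_imp_bounded finite_imageI finite)
qed

text \<open>The content of a plane triangle is half a 2 by 2 determinant, which in homogeneous
  coordinates is \<open>det M\<close> over the product of the three denominators, up to sign. This
  identifies the \<open>-1/2\<close> power in the theorem with the square root of the area, so that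
  both ratios share one denominator.\<close>

lemma unimodular_measure:
  assumes "unimodular_triangle M T"
  shows "measure lebesgue T =
    1 / (2 * real_of_int (M $ 1 $ 3) * real_of_int (M $ 2 $ 3) * real_of_int (M $ 3 $ 3))"
proof -
  define A B C where "A = rat_point (M $ 1)" and "B = rat_point (M $ 2)" and "C = rat_point (M $ 3)"
  have T: "T = convex hull {A, B, C}"
    using assms by (simp add: unimodular_triangle_def range_3 A_def B_def C_def)
  have pos: "M $ 1 $ 3 > 0" "M $ 2 $ 3 > 0" "M $ 3 $ 3 > 0" and "\<bar>det M\<bar> = 1"
    using assms by (auto simp: unimodular_triangle_def)
  then have d: "\<bar>real_of_int (det M)\<bar> = 1" by linarith
  have "compact T" unfolding T by (intro finite_imp_compact_convex_hull) auto
  then have "measure lebesgue T = measure lborel T"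
    by (intro measure_completion) (auto intro: borel_compact)
  also have "\<dots> = \<bar>(C $ 1 - A $ 1) * (B $ 2 - A $ 2) - (B $ 1 - A $ 1) * (C $ 2 - A $ 2)\<bar> / 2"
    unfolding T by (rule content_triangle)
  also have "(C $ 1 - A $ 1) * (B $ 2 - A $ 2) - (B $ 1 - A $ 1) * (C $ 2 - A $ 2)
     = - real_of_int (det M) / (real_of_int (M $ 1 $ 3) * real_of_int (M $ 2 $ 3) * real_of_int (M $ 3 $ 3))"
    using pos by (simp add: A_def B_def C_def det_3 field_simps)
  finally show ?thesis using pos d by (simp add: abs_mult)
qed

text \<open>Closed balls are convex, so one containing the vertices contains the hull. The
  right-hand side depends on the set alone, hence not on the matrix chosen to describe the
  triangle.\<close>

lemma MAX_dist_convex_hull: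
  fixes f :: "'i::finite \<Rightarrow> 'a::real_normed_vector"
  shows "(MAX i\<in>UNIV. dist x (f i)) = (SUP y\<in>convex hull (range f). dist x y)" (is "?m = _")
proof (rule sym, rule cSup_eq_maximum)
  have "?m \<in> range (\<lambda>i. dist x (f i))"
    by (rule Max_in) auto
  then show "?m \<in> dist x ` (convex hull (range f))"
    using hull_inc[of _ "range f"] by fastforce
next
  have "range f \<subseteq> cball x ?m"
    by auto
  then have "convex hull (range f) \<subseteq> cball x ?m"
    by (intro hull_minimal convex_cball)
  then show "\<And>d. d \<in> dist x ` (convex hull (range f)) \<Longrightarrow> d \<le> ?m" by auto
qed

text \<open>Frees the longest side, too, from the choice of matrix.\<close>

lemma longest_side_eq_diameter:
  "longest_side M = diameter (convex hull (range (\<lambda>i. rat_point (M $ i))))" (is "_ = diameter ?H")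
proof (rule antisym)
  have b: "bounded ?H"
    by (intro bounded_convex_hull finite_imp_bounded) auto
  have "dist (rat_point (M $ i)) (rat_point (M $ j)) \<le> diameter ?H" for i j
    by (intro diameter_bounded_bound[OF b] hull_inc) auto
  then show "longest_side M \<le> diameter ?H"
    by (simp add: longest_side_def)
next
  have "dist (rat_point (M $ i)) (rat_point (M $ j)) \<le> longest_side M" for i j
  proof -
    have "\<forall>i j. dist (rat_point (M $ i)) (rat_point (M $ j)) \<le> longest_side M"
      by (auto simp: forall_3 longest_side_def dist_commute
        intro: order_trans[OF zero_le_dist[of "rat_point (M $ 1)" "rat_point (M $ 2)"]])
    then show ?thesis by blast
  qed
  then have 1: "?H \<subseteq> cball (rat_point (M $ i)) (longest_side M)" for i
    by (intro hull_minimal convex_cball) auto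
  \<comment> \<open>The balls about the vertices put every hull point \<open>y\<close> within
    \<open>longest_side M\<close> of each vertex; convexity of the ball about \<open>y\<close> then
    reaches all pairs of hull points.\<close>
  have "?H \<subseteq> cball y (longest_side M)" if "y \<in> ?H" for y
    using 1 that by (intro hull_minimal convex_cball) (auto simp: dist_commute subset_iff)
  then show "diameter ?H \<le> longest_side M"
    by (intro diameter_le) (auto simp: dist_norm subset_iff)
qed

text \<open>Homogeneous form of barycentric coordinates: \<open>c i\<close> is the weight of vertex
  \<open>i\<close> divided by its denominator. Membership thus concerns nonnegative combinations of
  the integer rows, which behave linearly when a row is replaced.\<close>

lemma in_triangle_iff:
  fixes M :: "int^3^3"
  assumes "\<forall>i. M $ i $ 3 > 0"
  shows "x \<in> convex hull (range (\<lambda>i. rat_point (M $ i))) \<longleftrightarrow>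
    (\<exists>c :: 3 \<Rightarrow> real. (\<forall>i. c i \<ge> 0) \<and> (\<Sum>i\<in>UNIV. c i * of_int (M $ i $ 1)) = x $ 1 \<and>
      (\<Sum>i\<in>UNIV. c i * of_int (M $ i $ 2)) = x $ 2 \<and> (\<Sum>i\<in>UNIV. c i * of_int (M $ i $ 3)) = 1)"
    (is "_ \<longleftrightarrow> (\<exists>c. ?P c)")
proof
  assume "x \<in> convex hull (range (\<lambda>i. rat_point (M $ i)))"
  then obtain u v w where *: "0 \<le> u" "0 \<le> v" "0 \<le> w" "u + v + w = 1"
    "x = u *\<^sub>R rat_point (M $ 1) + v *\<^sub>R rat_point (M $ 2) + w *\<^sub>R rat_point (M $ 3)"
    by (auto simp: range_3 convex_hull_3)
  define c where "c i = (if i = 1 then u else if i = 2 then v else w) / of_int (M $ i $ 3)" for i :: 3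
  have "?P c"
    using assms * by (auto simp: c_def forall_3 sum_3 field_simps)
  then show "\<exists>c. ?P c" by blast
next
  assume "\<exists>c. ?P c"
  then obtain c where c: "?P c" by blast
  have 1: "x = (c 1 * M $ 1 $ 3) *\<^sub>R rat_point (M $ 1) + (c 2 * M $ 2 $ 3) *\<^sub>R rat_point (M $ 2)
     + (c 3 * M $ 3 $ 3) *\<^sub>R rat_point (M $ 3)"
    using c assms by (auto simp: vec_eq_iff forall_2 forall_3 sum_3)
  have 2: "0 \<le> c i * M $ i $ 3" for i
    using c assms by (simp add: less_imp_le)
  have 3: "c 1 * M $ 1 $ 3 + c 2 * M $ 2 $ 3 + c 3 * M $ 3 $ 3 = 1"
    using c by (simp add: sum_3)
  show "x \<in> convex hull (range (\<lambda>i. rat_point (M $ i)))"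
    using 1 2 3 unfolding range_3 convex_hull_3 by blast
qed

section \<open>Resolution of rational triangles\<close>

text \<open>The rows span a sublattice of index \<open>\<bar>det M\<bar>\<close>. If the inverse
  matrix were integral, \<open>det M\<close> would divide 1; so some unit vector has a non-integral
  coordinate with respect to the rows.\<close>

lemma exists_lattice_point:
  fixes M :: "int^3^3"
  assumes "det M \<noteq> 0" "\<bar>det M\<bar> \<noteq> 1"
  shows "\<exists>(t :: 3 \<Rightarrow> real) (v :: int^3). (\<forall>i. 0 \<le> t i \<and> t i < 1) \<and> (\<exists>i. t i > 0) \<and>
    (\<forall>k. (\<Sum>i\<in>UNIV. t i * of_int (M $ i $ k)) = of_int (v $ k))"
proof -
  define A :: "real^3^3" where "A = (\<chi> i j. of_int (M $ i $ j))"
  have "det A = of_int (det M)"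
    by (simp add: A_def det_3)
  then have "invertible A"
    using assms by (simp add: invertible_det_nz)
  then obtain B where B: "B ** A = mat 1" 
    by (auto simp: invertible_def)
  have "\<exists>i j. B $ i $ j \<notin> \<int>"
  proof (rule ccontr)
    assume "\<not> ?thesis"
    then have "\<forall>i j. \<exists>n :: int. B $ i $ j = of_int n"
      by (auto simp: Ints_def image_iff)
    then obtain N where N: "\<And>i j. B $ i $ j = of_int (N i j)"
      by metis
    have "det B = of_int (det (\<chi> i j. N i j))"
      by (simp add: N det_3)
    moreover have "det B * det A = 1"
      by (metis B det_mul det_I)
    ultimately have "of_int (det (\<chi> i j. N i j) * det M) = (1 :: real)"
      using \<open>det A = _\<close> by simp
    then have "det (\<chi> i j. N i j) * det M = 1"
      by linarith
    then have "det M dvd 1" by (metis dvd_triv_right)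
    then show False using assms by simp
  qed
  then obtain r j where rj: "B $ r $ j \<notin> \<int>" by blast
  \<comment> \<open>Row \<open>r\<close> of \<open>B\<close> lists the coordinates of the
    \<open>r\<close>-th unit vector with respect to the rows of \<open>M\<close>. Dropping integer
    parts moves that vector by an element of the row lattice, so the result \<open>v\<close> is
    still integral.\<close>
  define t where "t i = frac (B $ r $ i)" for i
  define v :: "int^3" where
    "v = (\<chi> k. (if r = k then 1 else 0) - (\<Sum>i\<in>UNIV. \<lfloor>B $ r $ i\<rfloor> * M $ i $ k))"
  have "(\<Sum>i\<in>UNIV. B $ r $ i * of_int (M $ i $ k)) = (if r = k then 1 else 0)" for k
    using arg_cong[OF B, of "\<lambda>C. C $ r $ k"] by (simp add: matrix_matrix_mult_def A_def mat_def)
  then have "(\<Sum>i\<in>UNIV. t i * of_int (M $ i $ k)) = of_int (v $ k)" for k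
    by (simp add: t_def v_def frac_def left_diff_distrib sum_subtractf)
  moreover have "0 \<le> t i \<and> t i < 1" for i
    by (simp add: t_def frac_lt_1)
  moreover have "t j > 0"
    using rj by (simp add: t_def)
  ultimately show ?thesis by blast
qed

text \<open>Star subdivision at a lattice point of the half-open parallelepiped spanned by the rows
  strictly decreases the determinant of the piece containing \<open>x\<close>.\<close>

lemma unimodular_refinement:
  fixes M :: "int^3^3"
  assumes "\<forall>i. M $ i $ 3 > 0" "det M \<noteq> 0" "x \<in> convex hull (range (\<lambda>i. rat_point (M $ i)))"
  shows "\<exists>M' T. unimodular_triangle M' T \<and> x \<in> T \<and> T \<subseteq> convex hull (range (\<lambda>i. rat_point (M $ i)))"
  using assms
proof (induction "nat \<bar>det M\<bar>" arbitrary: M rule: less_induct)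
  case less
  let ?H = "\<lambda>M. convex hull (range (\<lambda>i. rat_point (M $ i)))"
  show ?case
  proof (cases "\<bar>det M\<bar> = 1")
    case True
    then have "unimodular_triangle M (?H M)"
      using less.prems by (auto simp: unimodular_triangle_def)
    then show ?thesis using less.prems by blast
  next
    case False
    then obtain t :: "3 \<Rightarrow> real" and v :: "int^3" where t: "\<And>i. 0 \<le> t i" "\<And>i. t i < 1" "\<exists>i. t i > 0"
      and v: "\<And>k. (\<Sum>i\<in>UNIV. t i * of_int (M $ i $ k)) = of_int (v $ k)"
      using exists_lattice_point less.prems by blast
    obtain c :: "3 \<Rightarrow> real" where c: "\<And>i. 0 \<le> c i"
      "(\<Sum>i\<in>UNIV. c i * of_int (M $ i $ 1)) = x $ 1"
      "(\<Sum>i\<in>UNIV. c i * of_int (M $ i $ 2)) = x $ 2" 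
      "(\<Sum>i\<in>UNIV. c i * of_int (M $ i $ 3)) = 1"
      using less.prems in_triangle_iff by blast
    \<comment> \<open>The smallest ratio selects the piece of the subdivision that contains
      \<open>x\<close>: it is the largest multiple of \<open>v\<close> that can be split off while
      all remaining weights stay nonnegative.\<close>
    obtain l where l: "t l > 0" and l_min: "\<And>i. t i > 0 \<Longrightarrow> c l / t l \<le> c i / t i"
      using ex_is_arg_min_if_finite[of "{i. t i > 0}" "\<lambda>i. c i / t i"] t(3)
      by (auto simp: is_arg_min_linorder)
    define M' where "M' = (\<chi> i. if i = l then v else M $ i)"
    have M'_row: "M' $ i = (if i = l then v else M $ i)" for i
      by (simp add: M'_def)
    have "(\<Sum>i\<in>UNIV. t i * of_int (M $ i $ 3)) > 0"
      using less.prems l t by (intro sum_pos2[of _ l]) (auto simp: less_imp_le)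
    then have v3: "v $ 3 > 0" by (simp add: v)
    then have pos: "\<forall>i. M' $ i $ 3 > 0"
      using less.prems by (simp add: M'_row)
    \<comment> \<open>By multilinearity only the \<open>l\<close>-th summand of \<open>v\<close>
      survives in the determinant; the factor \<open>t l\<close> lies strictly between 0 and 1,
      which drives the induction.\<close>
    have "real_of_int (det M') = t l * of_int (det M)"
    proof -
      have "\<forall>l. of_int (det (\<chi> i. if i = l then v else M $ i)) = t l * of_int (det M)"
        by (simp add: forall_3 det_3 v[symmetric] sum_3) (simp add: algebra_simps)
      then show ?thesis by (simp add: M'_def)
    qed
    then have "det M' \<noteq> 0" "\<bar>real_of_int (det M')\<bar> < \<bar>real_of_int (det M)\<bar>"
      using l less.prems t(2)[of l] by (auto simp: abs_mult)
    then have small: "nat \<bar>det M'\<bar> < nat \<bar>det M\<bar>"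
      by linarith
    \<comment> \<open>Weights of \<open>x\<close> after row \<open>l\<close> has been eliminated in
      favour of \<open>v\<close>.\<close>
    define c' where "c' i = (if i = l then c l / t l else c i - t i * (c l / t l))" for i
    have c'_nonneg: "c' i \<ge> 0" for i
    proof (cases "t i > 0")
      case True
      then show ?thesis using l_min[OF True] c(1) l by (simp add: c'_def field_simps)
    next
      case False
      then have "t i = 0" using t(1)[of i] by simp
      then show ?thesis using c(1) l by (auto simp: c'_def)
    qed
    have "(\<Sum>i\<in>UNIV. c' i * of_int (M' $ i $ k)) = (\<Sum>i\<in>UNIV. c i * of_int (M $ i $ k))" for k
    proof -
      have "\<forall>l. t l > 0 \<longrightarrow> (\<Sum>i\<in>UNIV. (if i = l then c l / t l else c i - t i * (c l / t l)) *
          of_int ((if i = l then v else M $ i) $ k)) = (\<Sum>i\<in>UNIV. c i * of_int (M $ i $ k))"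
        by (simp add: forall_3 sum_3 v[symmetric]) (simp add: field_simps)
      then show ?thesis using l by (simp add: c'_def M'_row)
    qed
    then have "x \<in> ?H M'"
      unfolding in_triangle_iff[OF pos] using c c'_nonneg by (intro exI[of _ c']) simp
    then obtain M'' T where T: "unimodular_triangle M'' T" "x \<in> T" "T \<subseteq> ?H M'"
      using less.hyps[OF small pos \<open>det M' \<noteq> 0\<close>] by blast
    \<comment> \<open>The weights \<open>t\<close> become admissible after division by the third
      coordinate of \<open>v\<close>; hence the new triangle lies inside the old one.\<close>
    have "rat_point v \<in> ?H M"
      unfolding in_triangle_iff[OF less.prems(1)]
    proof (intro exI[of _ "\<lambda>i. t i / of_int (v $ 3)"] conjI allI)
      show "(\<Sum>i\<in>UNIV. t i / of_int (v $ 3) * of_int (M $ i $ 3)) = 1"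
        using v3 v[of 3] by (simp add: sum_divide_distrib[symmetric])
      show "(\<Sum>i\<in>UNIV. t i / of_int (v $ 3) * of_int (M $ i $ 1)) = rat_point v $ 1"
        using v[of 1] by (simp add: sum_divide_distrib[symmetric])
      show "(\<Sum>i\<in>UNIV. t i / of_int (v $ 3) * of_int (M $ i $ 2)) = rat_point v $ 2"
        using v[of 2] by (simp add: sum_divide_distrib[symmetric])
    qed (use t v3 in auto)
    then have "?H M' \<subseteq> ?H M"
      by (intro hull_minimal convex_convex_hull) (auto simp: M'_row hull_inc)
    then show ?thesis using T by blast
  qed
qed

text \<open>A right triangle on the grid of mesh \<open>1/n\<close> contains \<open>x\<close> but
  has determinant \<open>4 * n\<close>; the refinement lemma replaces it by a unimodular triangle
  inside it.\<close>

lemma exists_small_unimodular_triangle: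
  fixes x :: "real^2"
  assumes "e > 0"
  shows "\<exists>M T. unimodular_triangle M T \<and> x \<in> T \<and> T \<subseteq> ball x e"
proof -
  obtain n :: nat where n: "n > 0" "4 / e < real n"
    using reals_Archimedean2[of "4 / e"] assms
    by (metis divide_pos_pos of_nat_0_less_iff order.strict_trans zero_less_numeral)
  define a b where "a = \<lfloor>n * x $ 1\<rfloor>" and "b = \<lfloor>n * x $ 2\<rfloor>"
  \<comment> \<open>The legs are two mesh widths long: \<open>x\<close> lies in the grid cell at
    \<open>(a/n, b/n)\<close>, so \<open>u\<close> and \<open>w\<close> below are less than 1/2 and
    the weight \<open>1 - u - w\<close> is positive.\<close>
  define M :: "int^3^3" where
    "M = vector [vector [a, b, n], vector [a + 2, b, n], vector [a, b + 2, n]]"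
  have M: "M $ 1 = vector [a, b, n]" "M $ 2 = vector [a + 2, b, n]" "M $ 3 = vector [a, b + 2, n]"
    by (simp_all add: M_def vector_def)
  have pos: "\<forall>i. M $ i $ 3 > 0"
    using n by (simp add: forall_3 M)
  have "det M = 4 * int n"
    by (simp add: det_3 M algebra_simps)
  then have det: "det M \<noteq> 0" using n by simp
  define u w where "u = (n * x $ 1 - a) / 2" and "w = (n * x $ 2 - b) / 2"
  have uw: "0 \<le> u" "u < 1/2" "0 \<le> w" "w < 1/2"
    using floor_correct[of "n * x $ 1"] floor_correct[of "n * x $ 2"]
    by (auto simp: u_def w_def a_def b_def) linarith+
  have xe: "x $ 1 = (a + 2 * u) / n" "x $ 2 = (b + 2 * w) / n"
    using n by (simp_all add: u_def w_def field_simps)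
  have x: "x \<in> convex hull (range (\<lambda>i. rat_point (M $ i)))"
    unfolding in_triangle_iff[OF pos]
    using uw n
    by (intro exI[of _ "\<lambda>i. (if i = 1 then 1 - u - w else if i = 2 then u else w) / n"])
       (auto simp: forall_3 sum_3 M u_def w_def field_simps)
  have near: "dist x (rat_point (M $ i)) < e" for i
  proof -
    have "\<forall>i. \<bar>(x - rat_point (M $ i)) $ 1\<bar> \<le> 2 / n \<and> \<bar>(x - rat_point (M $ i)) $ 2\<bar> \<le> 2 / n"
      using uw n by (auto simp: forall_3 M xe diff_divide_distrib[symmetric] intro!: divide_right_mono)
    then have "\<bar>(x - rat_point (M $ i)) $ 1\<bar> + \<bar>(x - rat_point (M $ i)) $ 2\<bar> \<le> 2 / n + 2 / n"
      by (intro add_mono) auto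
    moreover have "2 / n + 2 / n < e"
      using n assms by (simp add: field_simps)
    moreover have "norm (x - rat_point (M $ i)) \<le> \<bar>(x - rat_point (M $ i)) $ 1\<bar> + \<bar>(x - rat_point (M $ i)) $ 2\<bar>"
      using norm_le_l1_cart[of "x - rat_point (M $ i)"] by (simp add: sum_2)
    ultimately show ?thesis by (simp add: dist_norm)
  qed
  then have "convex hull (range (\<lambda>i. rat_point (M $ i))) \<subseteq> ball x e"
    by (intro hull_minimal convex_ball) auto
  then show ?thesis
    using unimodular_refinement[OF pos det x] by blast
qed

section \<open>Nearly equilateral unimodular triangles\<close>

text \<open>Finds third coordinates \<open>a\<close> and \<open>b\<close> for the lifts of the two
  lattice basis vectors; the divisibility conditions say that the remaining coordinates of the lifts
  are integers.\<close>

lemma exists_denominators: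
  fixes r s i j :: int
  assumes "r > 0" "s > 0" "coprime (2 * s) r" "coprime i (2 * s)" "coprime j (2 * r)"
  obtains a b :: int where "a > 0" "b > 0" "2 * r dvd a" "2 * s dvd 2 + a * i"
    "2 * s dvd 1 + b * i" "2 * r dvd 1 + b * j"
proof -
  have cop: "coprime (r * i) s" "coprime i (2 * s)" "coprime j r" "coprime (2 * s) r" "odd j"
    using assms by (auto simp: coprime_commute)
  obtain k where "[r * i * k = 1] (mod s)"
    using cong_solve_coprime_int[OF cop(1)] by blast
  then have k: "s dvd 1 - r * i * k"
    by (auto simp: cong_iff_dvd_diff dvd_diff_commute)
  obtain x where "[i * x = 1] (mod (2 * s))"
    using cong_solve_coprime_int[OF cop(2)] by blast
  then have x: "2 * s dvd 1 - i * x"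
    by (auto simp: cong_iff_dvd_diff dvd_diff_commute)
  obtain y where "[j * y = 1] (mod r)"
    using cong_solve_coprime_int[OF cop(3)] by blast
  then have y: "r dvd 1 - j * y"
    by (auto simp: cong_iff_dvd_diff dvd_diff_commute)
  obtain b where b: "[b = - x] (mod (2 * s))" "[b = - y] (mod r)"
    using binary_chinese_remainder_int[OF cop(4)] by blast
  \<comment> \<open>With this choice \<open>2 + a * i\<close> is twice \<open>1 - r * i * k\<close>,
    a multiple of \<open>s\<close>.\<close>
  define a where "a = - 2 * r * k"
  have a1: "2 * r dvd a" "2 * s dvd 2 + a * i"
    using k mult_dvd_mono[OF dvd_refl[of 2] k] by (auto simp: a_def algebra_simps)
  have b1: "2 * s dvd 1 + b * i"
    using dvd_add[OF x dvd_mult2[of "2 * s" "b + x" i]] b by (auto simp: cong_iff_dvd_diff algebra_simps)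
  have b2: "r dvd 1 + b * j"
    using dvd_add[OF y dvd_mult2[of r "b + y" j]] b by (auto simp: cong_iff_dvd_diff algebra_simps)
  \<comment> \<open>The remainder theorem controls \<open>b\<close> modulo \<open>r\<close> only;
    since \<open>r\<close> is odd, parity supplies the missing factor 2.\<close>
  have "odd b"
    using dvd_trans[OF dvd_triv_left b1] by auto
  then have "2 dvd 1 + b * j" using \<open>odd j\<close> by simp
  then have b3: "2 * r dvd 1 + b * j"
    using b2 assms by (intro divides_mult) auto
  \<comment> \<open>Shifting by a multiple of \<open>2 * r * s\<close> preserves every congruence
    and makes both numbers positive.\<close>
  define N where "N = (\<bar>a\<bar> + \<bar>b\<bar> + 1)"
  define a' b' where "a' = a + 2 * r * s * N" and "b' = b + 2 * r * s * N"
  have "1 \<le> 2 * r * s"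
    using mult_pos_pos[OF assms(1,2)] unfolding mult.assoc by linarith
  then have "1 * N \<le> (2 * r * s) * N"
    by (intro mult_right_mono) (auto simp: N_def)
  moreover have "N > - a" "N > - b"
    unfolding N_def by linarith+
  ultimately have "a' > 0" "b' > 0"
    unfolding a'_def b'_def by linarith+
  moreover have "2 * r dvd a'"
    unfolding a'_def by (intro dvd_add a1) auto
  moreover have "2 + a' * i = (2 + a * i) + 2 * s * (r * N * i)" "1 + b' * i = (1 + b * i) + 2 * s * (r * N * i)"
    "1 + b' * j = (1 + b * j) + 2 * r * (s * N * j)"
    by (simp_all add: a'_def b'_def algebra_simps)
  then have "2 * s dvd 2 + a' * i" "2 * s dvd 1 + b' * i" "2 * r dvd 1 + b' * j"
    using a1 b1 b3 by (metis dvd_add dvd_triv_left)+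
  ultimately show ?thesis by (rule that)
qed

text \<open>The second and third vertices differ from the first by the lattice basis vectors
  \<open>(1/s, 0)\<close> and \<open>(1/(2s), 1/(2r))\<close>, divided by \<open>a\<close> and
  \<open>b\<close>.\<close>

lemma unimodular_triangle_at_lattice_point:
  fixes r s i j a b :: int
  assumes "r > 0" "s > 0" "a > 0" "b > 0" "2 * r dvd a" "2 * s dvd 2 + a * i"
    "2 * s dvd 1 + b * i" "2 * r dvd 1 + b * j"
  obtains M where "unimodular_triangle M (convex hull (range (\<lambda>i. rat_point (M $ i))))"
    "M $ 1 $ 3 = 2 * r * s" "M $ 2 $ 3 = a" "M $ 3 $ 3 = b"
    "rat_point (M $ 1) = vector [i / (2 * s), j / (2 * r)]"
    "rat_point (M $ 2) = vector [i / (2 * s) + 1 / (s * a), j / (2 * r)]"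
    "rat_point (M $ 3) = vector [i / (2 * s) + 1 / (2 * s * b), j / (2 * r) + 1 / (2 * r * b)]"
proof -
  obtain a0 a1 b1 b2 where k: "a = 2 * r * a0" "2 + a * i = 2 * s * a1"
    "1 + b * i = 2 * s * b1" "1 + b * j = 2 * r * b2"
    using assms by (auto simp: dvd_def)
  define M :: "int^3^3" where
    "M = vector [vector [i * r, j * s, 2 * r * s], vector [a1, a0 * j, a], vector [b1, b2, b]]"
  have M: "M $ 1 = vector [i * r, j * s, 2 * r * s]" "M $ 2 = vector [a1, a0 * j, a]" "M $ 3 = vector [b1, b2, b]"
    by (simp_all add: M_def vector_def)
  \<comment> \<open>The factor \<open>4 * r * s\<close> lets each quotient from \<open>k\<close>
    appear with its divisor, so that all four can be replaced by polynomials in \<open>a\<close>,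
    \<open>b\<close>, \<open>i\<close>, \<open>j\<close>.\<close>
  have "4 * r * s * det M = (2 * s) * (2 * r) *
      ((i * r) * (a0 * j) * b + (j * s) * a * b1 + (2 * r * s) * a1 * b2
       - (i * r) * a * b2 - (j * s) * a1 * b - (2 * r * s) * (a0 * j) * b1)"
    by (simp add: det_3 M algebra_simps)
  also have "\<dots> = 4 * r * s"
  proof -
    have "(2 * s) * (2 * r) *
      ((i * r) * (a0 * j) * b + (j * s) * a * b1 + (2 * r * s) * a1 * b2
       - (i * r) * a * b2 - (j * s) * a1 * b - (2 * r * s) * (a0 * j) * b1)
      = (2 * s) * r * (i * (2 * r * a0) * j * b) + j * s * (2 * r) * a * (2 * s * b1) + 2 * r * s * (2 * s * a1) * (2 * r * b2)
       - i * r * (2 * s) * a * (2 * r * b2) - j * s * (2 * r) * (2 * s * a1) * b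
       - 2 * r * s * (2 * r * a0) * j * (2 * s * b1)"
      by (simp add: algebra_simps)
    also have "\<dots> = 4 * r * s"
      unfolding k[symmetric] by (simp add: algebra_simps)
    finally show ?thesis .
  qed
  finally have "det M = 1" using assms by simp
  moreover have "\<forall>i. M $ i $ 3 > 0"
    using assms by (simp add: forall_3 M)
  ultimately have "unimodular_triangle M (convex hull (range (\<lambda>i. rat_point (M $ i))))"
    by (simp add: unimodular_triangle_def)
  moreover have "M $ 1 $ 3 = 2 * r * s" "M $ 2 $ 3 = a" "M $ 3 $ 3 = b"
    by (simp_all add: M)
  moreover have "real_of_int a1 = (2 + a * i) / (2 * s)" "real_of_int a0 = a / (2 * r)"
    "real_of_int b1 = (1 + b * i) / (2 * s)" "real_of_int b2 = (1 + b * j) / (2 * r)"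
    using arg_cong[OF k(1), of real_of_int] arg_cong[OF k(2), of real_of_int]
      arg_cong[OF k(3), of real_of_int] arg_cong[OF k(4), of real_of_int] assms(1,2)
    by (simp_all add: field_simps)
  then have "rat_point (M $ 1) = vector [i / (2 * s), j / (2 * r)]"
    "rat_point (M $ 2) = vector [i / (2 * s) + 1 / (s * a), j / (2 * r)]"
    "rat_point (M $ 3) = vector [i / (2 * s) + 1 / (2 * s * b), j / (2 * r) + 1 / (2 * r * b)]"
    using assms by (simp_all add: vec_eq_iff forall_2 M field_simps)
  ultimately show ?thesis by (rule that)
qed

section \<open>Asymptotic shape of the triangles at a lattice point\<close>

lemma dist_real2_squared:
  fixes u v :: "real^2"
  shows "(dist u v)\<^sup>2 = (u $ 1 - v $ 1)\<^sup>2 + (u $ 2 - v $ 2)\<^sup>2"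
  by (simp add: dist_vec_def L2_set_def sum_2 dist_real_def)

text \<open>The triangle spanned by the lattice basis has area \<open>1/(4rs)\<close>; its squared
  sides divided by this area are \<open>4r/s\<close> once and \<open>s/r + r/s\<close> twice. The
  unimodular triangles tend to this shape when \<open>a\<close> and \<open>b\<close> grow with ratio
  tending to 1, so strict bounds for the limit shape carry over.\<close>

lemma small_triangles_at_lattice_point:
  fixes r s i j :: int and c :: real
  assumes rs: "r > 0" "s > 0" and cop: "coprime (2 * s) r" "coprime i (2 * s)" "coprime j (2 * r)"
  assumes U: "open U" "vector [i / (2 * s), j / (2 * r)] \<in> U"
  assumes c: "c > 0" "4 * (r / s) < c\<^sup>2" "s / r + r / s < c\<^sup>2"
  shows "\<exists>M T. unimodular_triangle M T \<and> T \<subseteq> U \<and> diameter T < c * sqrt (measure lebesgue T)"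
proof -
  obtain a0 b0 where ab: "a0 > 0" "b0 > 0" "2 * r dvd a0" "2 * s dvd 2 + a0 * i"
    "2 * s dvd 1 + b0 * i" "2 * r dvd 1 + b0 * j"
    using exists_denominators[OF rs cop] by metis
  \<comment> \<open>Equal increments keep the congruences and force \<open>a n / b n\<close> to tend
    to 1.\<close>
  define a b where "a n = a0 + 2 * r * s * int n" and "b n = b0 + 2 * r * s * int n" for n
  have pos: "a n > 0" "b n > 0" for n
    using ab rs by (auto simp: a_def b_def intro: add_pos_nonneg)
  have "2 + a n * i = (2 + a0 * i) + 2 * s * (r * n * i)" "1 + b n * i = (1 + b0 * i) + 2 * s * (r * n * i)"
    "1 + b n * j = (1 + b0 * j) + 2 * r * (s * n * j)" "a n = a0 + 2 * r * (s * n)" for n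
    by (simp_all add: a_def b_def algebra_simps)
  then have dvd: "2 * r dvd a n" "2 * s dvd 2 + a n * i" "2 * s dvd 1 + b n * i" "2 * r dvd 1 + b n * j" for n
    using ab by (metis dvd_add dvd_triv_left)+
  define P :: "real^2" where "P = vector [i / (2 * s), j / (2 * r)]"
  define Q R :: "nat \<Rightarrow> real^2"
    where "Q n = vector [i / (2 * s) + 1 / (s * a n), j / (2 * r)]"
      and "R n = vector [i / (2 * s) + 1 / (2 * s * b n), j / (2 * r) + 1 / (2 * r * b n)]" for n
  have real_ab: "real_of_int (a n) = a0 + 2 * r * s * real n" "real_of_int (b n) = b0 + 2 * r * s * real n" for n
    by (simp_all add: a_def b_def)
  have rs': "real_of_int r > 0" "real_of_int s > 0" "0 < real_of_int (2 * r * s)"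
    using rs by simp_all
  have quotient: "(\<lambda>n. (x + D * real n) / (y + D * real n)) \<longlonglongrightarrow> 1"
    and inf: "filterlim (\<lambda>n. x + D * real n) at_top sequentially" if "D > 0" for x y D :: real
    using that by real_asymp+
  have a_inf: "filterlim (\<lambda>n. real_of_int (a n)) at_top sequentially"
    and b_inf: "filterlim (\<lambda>n. real_of_int (b n)) at_top sequentially"
    and ba: "(\<lambda>n. real_of_int (b n) / real_of_int (a n)) \<longlonglongrightarrow> 1"
    and ab': "(\<lambda>n. real_of_int (a n) / real_of_int (b n)) \<longlonglongrightarrow> 1"
    unfolding real_ab by (rule quotient inf, rule rs'(3))+
  have Q: "Q \<longlonglongrightarrow> P"
  proof (rule vec_tendstoI)
    have "(\<lambda>n. 1 / s * inverse (real_of_int (a n))) \<longlonglongrightarrow> 1 / s * 0"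
      by (intro tendsto_mult tendsto_const tendsto_inverse_0_at_top[OF a_inf])
    then have "(\<lambda>n. i / (2 * s) + 1 / s * inverse (real_of_int (a n))) \<longlonglongrightarrow> i / (2 * s) + 1 / s * 0"
      by (intro tendsto_add tendsto_const)
    then have "\<forall>k. (\<lambda>n. Q n $ k) \<longlonglongrightarrow> P $ k"
      by (simp add: forall_2 Q_def P_def field_simps)
    then show "(\<lambda>n. Q n $ k) \<longlonglongrightarrow> P $ k" for k by blast
  qed
  have R: "R \<longlonglongrightarrow> P"
  proof (rule vec_tendstoI)
    have "(\<lambda>n. z + 1 / (2 * y) * inverse (real_of_int (b n))) \<longlonglongrightarrow> z + 1 / (2 * y) * 0" for y z
      by (intro tendsto_add tendsto_mult tendsto_const tendsto_inverse_0_at_top[OF b_inf])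
    from this[of "i / (2 * s)" s] this[of "j / (2 * r)" r]
    have "\<forall>k. (\<lambda>n. R n $ k) \<longlonglongrightarrow> P $ k"
      by (simp add: forall_2 R_def P_def field_simps)
    then show "(\<lambda>n. R n $ k) \<longlonglongrightarrow> P $ k" for k by blast
  qed
  \<comment> \<open>The area of the triangle with denominators \<open>2 * r * s\<close>,
    \<open>a n\<close> and \<open>b n\<close>.\<close>
  define A where "A n = 1 / (4 * r * s * a n * b n)" for n
  have A_pos: "A n > 0" for n
    using rs pos[of n] by (simp add: A_def)
  have 1: "(\<lambda>n. (dist P (Q n))\<^sup>2 / A n) \<longlonglongrightarrow> 4 * (r / s)"
  proof -
    have "(dist P (Q n))\<^sup>2 / A n = 4 * (r / s) * (real_of_int (b n) / real_of_int (a n))" for n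
      unfolding dist_real2_squared using rs' pos[of n]
      by (simp add: P_def Q_def A_def field_simps power2_eq_square)
    then show ?thesis using tendsto_mult[OF tendsto_const ba, of "4 * (r / s)"] by simp
  qed
  have 2: "(\<lambda>n. (dist P (R n))\<^sup>2 / A n) \<longlonglongrightarrow> s / r + r / s"
  proof -
    have "(dist P (R n))\<^sup>2 / A n = (s / r + r / s) * (real_of_int (a n) / real_of_int (b n))" for n
      unfolding dist_real2_squared using rs' pos[of n]
      by (simp add: P_def R_def A_def field_simps power2_eq_square)
    then show ?thesis using tendsto_mult[OF tendsto_const ab', of "s / r + r / s"] by simp
  qed
  have 3: "(\<lambda>n. (dist (Q n) (R n))\<^sup>2 / A n) \<longlonglongrightarrow> s / r + r / s"
  proof -
    \<comment> \<open>In units of \<open>1 / a n\<close> the difference of \<open>Q n\<close> and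
      \<open>R n\<close> depends on \<open>q n\<close> alone, so the normalised side has a limit
      although both vertices collapse to \<open>P\<close>.\<close>
    define p q where "p n = real_of_int (b n) / real_of_int (a n)" and "q n = real_of_int (a n) / real_of_int (b n)" for n
    have pq: "p \<longlonglongrightarrow> 1" "q \<longlonglongrightarrow> 1"
      unfolding p_def q_def by (fact ba ab')+
    have alg: "((X / x)\<^sup>2 + (- Y / x)\<^sup>2) / (1 / (w * x * y)) = y / x * w * (X\<^sup>2 + Y\<^sup>2)"
      if "x > 0" "y > 0" for x y w X Y :: real
      using that by (simp add: field_simps power2_eq_square)
    have "(dist (Q n) (R n))\<^sup>2 / A n
        = p n * (4 * r * s) * ((1 / s - q n / (2 * s))\<^sup>2 + (q n / (2 * r))\<^sup>2)" for n
    proof -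
      have *: "Q n $ 1 - R n $ 1 = (1 / s - q n / (2 * s)) / a n" "Q n $ 2 - R n $ 2 = - (q n / (2 * r)) / a n"
        using rs' pos[of n] by (simp_all add: Q_def R_def q_def field_simps)
      have A: "A n = 1 / (real_of_int (4 * r * s) * a n * b n)"
        by (simp add: A_def)
      show ?thesis
        unfolding dist_real2_squared * A p_def using pos[of n] by (intro alg) auto
    qed
    moreover have "(\<lambda>n. p n * (4 * r * s) * ((1 / s - q n / (2 * s))\<^sup>2 + (q n / (2 * r))\<^sup>2))
       \<longlonglongrightarrow> 1 * real_of_int (4 * r * s) * ((1 / s - 1 / (2 * s))\<^sup>2 + (1 / (2 * r))\<^sup>2)"
      using rs' by (intro tendsto_mult tendsto_add tendsto_power tendsto_diff tendsto_divide tendsto_const pq) auto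
    moreover have "1 * real_of_int (4 * r * s) * ((1 / s - 1 / (2 * s))\<^sup>2 + (1 / (2 * r))\<^sup>2) = s / r + r / s"
      using rs' by (simp add: field_simps power2_eq_square)
    ultimately show ?thesis by simp
  qed
  obtain e where e: "e > 0" "ball P e \<subseteq> U"
    using U by (auto simp: P_def open_contains_ball)
  have "\<forall>\<^sub>F n in sequentially. dist (Q n) P < e \<and> dist (R n) P < e \<and> (dist P (Q n))\<^sup>2 / A n < c\<^sup>2 \<and>
      (dist P (R n))\<^sup>2 / A n < c\<^sup>2 \<and> (dist (Q n) (R n))\<^sup>2 / A n < c\<^sup>2"
    using order_tendstoD(2)[OF 1 c(2)] order_tendstoD(2)[OF 2 c(3)] order_tendstoD(2)[OF 3 c(3)]
      tendstoD[OF Q e(1)] tendstoD[OF R e(1)]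
    by eventually_elim simp
  then obtain n where n: "dist (Q n) P < e" "dist (R n) P < e" "(dist P (Q n))\<^sup>2 / A n < c\<^sup>2"
      "(dist P (R n))\<^sup>2 / A n < c\<^sup>2" "(dist (Q n) (R n))\<^sup>2 / A n < c\<^sup>2"
    by (auto simp: eventually_sequentially)
  obtain M where M: "unimodular_triangle M (convex hull (range (\<lambda>i. rat_point (M $ i))))"
    "M $ 1 $ 3 = 2 * r * s" "M $ 2 $ 3 = a n" "M $ 3 $ 3 = b n"
    "rat_point (M $ 1) = P" "rat_point (M $ 2) = Q n" "rat_point (M $ 3) = R n"
    using unimodular_triangle_at_lattice_point[OF rs pos[of n] dvd[of n], folded P_def Q_def R_def]
    by blast
  let ?T = "convex hull (range (\<lambda>i. rat_point (M $ i)))"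
  have area: "measure lebesgue ?T = A n"
    unfolding unimodular_measure[OF M(1)] M A_def by simp
  have less: "d < c * sqrt (A n)" if "d\<^sup>2 / A n < c\<^sup>2" for d
  proof (rule power2_less_imp_less)
    show "d\<^sup>2 < (c * sqrt (A n))\<^sup>2"
      using that A_pos[of n] by (simp add: power_mult_distrib field_simps)
  qed (use c A_pos[of n] in \<open>simp add: less_imp_le\<close>)
  have "diameter ?T < c * sqrt (measure lebesgue ?T)"
    unfolding area longest_side_eq_diameter[symmetric] longest_side_def M
    using n by (auto simp: less dist_commute)
  moreover have "?T \<subseteq> ball P e"
    using n e by (intro hull_minimal convex_ball) (auto simp: range_3 M dist_commute)
  ultimately show ?thesis using M(1) e(2) by blast
qed

text \<open>Provides base points arbitrarily close to \<open>(y, z)\<close> whose projected lattices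
  are arbitrarily close to hexagonal, under the coprimality conditions needed for the
  denominators.\<close>

lemma lattice_parameters_dense:
  fixes y z :: real
  obtains r s i j :: "nat \<Rightarrow> int"
  where "\<And>n. r n > 0" "\<And>n. s n > 0" "\<And>n. coprime (2 * s n) (r n)"
    "\<And>n. coprime (i n) (2 * s n)" "\<And>n. coprime (j n) (2 * r n)"
    "(\<lambda>n. s n / r n) \<longlonglongrightarrow> sqrt 3" "(\<lambda>n. i n / (2 * s n)) \<longlonglongrightarrow> y" "(\<lambda>n. j n / (2 * r n)) \<longlonglongrightarrow> z"
proof -
  define s m k r i j :: "nat \<Rightarrow> int" where
    "s n = 2 ^ n" and "m n = 2 * int n + 1" and
    "k n = 2 * \<lfloor>2 ^ n / (2 * sqrt 3 * m n ^ 2)\<rfloor> + 1" and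
    "r n = (m n)\<^sup>2 * k n" and
    "i n = 2 * \<lfloor>2 ^ n * y\<rfloor> + 1" and
    "j n = 2 * \<lfloor>z * m n\<rfloor> * m n * k n + 1" for n
  txt \<open>An odd \<open>i\<close> is coprime to a power of two, and \<open>j\<close> is congruent to 1 modulo \<open>m k\<close>; the square
    in \<open>r\<close> makes \<open>j / (2 r)\<close> equal to \<open>\<lfloor>z m\<rfloor> / m\<close> up to \<open>1 / (2 r)\<close>.\<close>
  have s_pos: "s n > 0" and m_pos: "m n > 0" for n
    by (auto simp: s_def m_def)
  have "\<lfloor>2 ^ n / (2 * sqrt 3 * m n ^ 2)\<rfloor> \<ge> 0" for n
    by simp
  then have k_pos: "k n > 0" for n
    unfolding k_def using add_nonneg_pos[of _ "1 :: int"] by simp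
  have r_pos: "r n > 0" for n
    using m_pos[of n] k_pos[of n] by (simp add: r_def)
  have odd: "odd (r n)" "odd (i n)" "odd (j n)" for n
    by (auto simp: r_def k_def m_def i_def j_def)
  have c1: "coprime (2 * s n) (r n)" "coprime (i n) (2 * s n)" for n
    using odd[of n] by (auto simp: s_def coprime_commute)
  have "coprime (x * q + 1) x" for x q :: int
    by (rule coprimeI) (metis dvd_add_right_iff dvd_mult2)
  from this[of "m n" "2 * \<lfloor>z * m n\<rfloor> * k n" for n] this[of "k n" "2 * \<lfloor>z * m n\<rfloor> * m n" for n]
  have "coprime (j n) (m n)" "coprime (j n) (k n)" for n
    unfolding j_def by (simp_all add: ac_simps)
  then have c2: "coprime (j n) (2 * r n)" for n
    using odd[of n] by (auto simp: r_def)
  \<comment> \<open>\<open>k n\<close> is an odd integer within 1 of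
    \<open>2 ^ n / (sqrt 3 * m n ^ 2)\<close>. The resulting error vanishes in the limit because
    \<open>m n\<close> grows only linearly.\<close>
  have r_bound: "\<bar>real_of_int (r n) / s n - 1 / sqrt 3\<bar> \<le> m n ^ 2 / 2 ^ n" for n
  proof -
    let ?q = "2 ^ n / (2 * sqrt 3 * m n ^ 2)"
    have "\<bar>real_of_int (k n) - 2 * ?q\<bar> \<le> 1"
      unfolding k_def using floor_correct[of ?q] by linarith
    then have "real_of_int ((m n)\<^sup>2) / 2 ^ n * \<bar>real_of_int (k n) - 2 * ?q\<bar> \<le> real_of_int ((m n)\<^sup>2) / 2 ^ n * 1"
      by (intro mult_left_mono) auto
    moreover have "real_of_int (r n) / s n - 1 / sqrt 3 = real_of_int ((m n)\<^sup>2) / 2 ^ n * (real_of_int (k n) - 2 * ?q)"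
      using m_pos[of n] by (simp add: r_def s_def field_simps)
    ultimately show ?thesis by (simp add: abs_mult)
  qed
  have "(\<lambda>n. real_of_int (m n ^ 2) / 2 ^ n) \<longlonglongrightarrow> 0"
    unfolding m_def by simp real_asymp
  then have "(\<lambda>n. real_of_int (r n) / s n - 1 / sqrt 3) \<longlonglongrightarrow> 0"
    by (rule Lim_null_comparison[rotated]) (use r_bound in simp)
  then have "(\<lambda>n. real_of_int (r n) / s n) \<longlonglongrightarrow> 1 / sqrt 3"
    by (simp add: LIM_zero_iff)
  from tendsto_inverse[OF this] have l1: "(\<lambda>n. s n / r n) \<longlonglongrightarrow> sqrt 3"
    by (simp add: inverse_eq_divide)
  have l2: "(\<lambda>n. i n / (2 * s n)) \<longlonglongrightarrow> y"
  proof -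
    have bound: "\<bar>real_of_int (i n) / (2 * s n) - y\<bar> \<le> 1 / 2 ^ n" for n
    proof -
      have "\<bar>real_of_int (i n) - 2 * (2 ^ n * y)\<bar> \<le> 2"
        unfolding i_def using floor_correct[of "2 ^ n * y"] by linarith
      moreover have "real_of_int (i n) / (2 * s n) - y = (real_of_int (i n) - 2 * (2 ^ n * y)) / (2 * 2 ^ n)"
        by (simp add: s_def field_simps)
      ultimately show ?thesis by (simp only: abs_divide) (simp add: field_simps)
    qed
    have "(\<lambda>n. 1 / 2 ^ n :: real) \<longlonglongrightarrow> 0" by real_asymp
    then have "(\<lambda>n. i n / (2 * s n) - y) \<longlonglongrightarrow> 0"
      by (rule Lim_null_comparison[rotated], intro always_eventually allI)
        (simp only: real_norm_def bound)
    then show ?thesis by (simp add: LIM_zero_iff)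
  qed
  have l3: "(\<lambda>n. j n / (2 * r n)) \<longlonglongrightarrow> z"
  proof -
    have bound: "\<bar>real_of_int (j n) / (2 * r n) - z\<bar> \<le> 2 / m n" for n
    proof -
      have pos: "real_of_int (m n) > 0" "real_of_int (k n) > 0" "real_of_int (m n) \<ge> 1" "real_of_int (k n) \<ge> 1"
        using m_pos[of n] k_pos[of n] by linarith+
      have "\<bar>real_of_int \<lfloor>z * m n\<rfloor> - z * m n\<bar> \<le> 1"
        using floor_correct[of "z * m n"] by linarith
      moreover have "1 * 1 \<le> real_of_int (m n) * real_of_int (k n)"
        using pos by (intro mult_mono) auto
      then have "1 / (2 * real_of_int (m n) * k n) \<le> 1"
        using pos by (simp add: field_simps)
      ultimately have "\<bar>(real_of_int \<lfloor>z * m n\<rfloor> - z * m n) + 1 / (2 * real_of_int (m n) * k n)\<bar> \<le> 2"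
        using pos by (smt (verit) divide_nonneg_nonneg mult_nonneg_nonneg)
      moreover have "real_of_int (j n) / (2 * r n) - z =
          ((real_of_int \<lfloor>z * m n\<rfloor> - z * m n) + 1 / (2 * real_of_int (m n) * k n)) / m n"
        using pos by (simp add: j_def r_def field_simps power2_eq_square)
      ultimately show ?thesis using pos by (simp add: abs_divide divide_right_mono)
    qed
    have "(\<lambda>n. 2 / m n :: real) \<longlonglongrightarrow> 0"
      unfolding m_def by simp real_asymp
    then have "(\<lambda>n. j n / (2 * r n) - z) \<longlonglongrightarrow> 0"
      by (rule Lim_null_comparison[rotated], intro always_eventually allI)
        (simp only: real_norm_def bound)
    then show ?thesis by (simp add: LIM_zero_iff)
  qed
  show ?thesis
    using that[OF r_pos s_pos c1 c2 l1 l2 l3] .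
qed

text \<open>At \<open>s / r = sqrt 3\<close> the normalised squared sides \<open>4r/s\<close> and
  \<open>s/r + r/s\<close> both equal \<open>4 / sqrt 3\<close>, the square of the equilateral
  value; parameters close to this limit therefore satisfy both strict bounds.\<close>

lemma nearly_equilateral_triangles_dense:
  fixes U :: "(real^2) set"
  assumes "open U" "U \<noteq> {}" "2 * (1 / 3) powr (1 / 4) < c"
  shows "\<exists>M T. unimodular_triangle M T \<and> T \<subseteq> U \<and> diameter T < c * sqrt (measure lebesgue T)"
proof -
  obtain y where "y \<in> U" using assms by blast
  show ?thesis
  proof (rule lattice_parameters_dense[of "y $ 1" "y $ 2"])
    fix r s i j :: "nat \<Rightarrow> int"
    assume *: "\<And>n. r n > 0" "\<And>n. s n > 0" "\<And>n. coprime (2 * s n) (r n)"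
        "\<And>n. coprime (i n) (2 * s n)" "\<And>n. coprime (j n) (2 * r n)"
      and lim: "(\<lambda>n. s n / r n) \<longlonglongrightarrow> sqrt 3" "(\<lambda>n. i n / (2 * s n)) \<longlonglongrightarrow> y $ 1" "(\<lambda>n. j n / (2 * r n)) \<longlonglongrightarrow> y $ 2"
    have inv: "(\<lambda>n. r n / s n) \<longlonglongrightarrow> 1 / sqrt 3"
      using tendsto_inverse[OF lim(1)] by (simp add: inverse_eq_divide)
    have pos: "0 < (1 / 3 :: real) powr (1 / 4)" by simp
    have "(2 * (1 / 3) powr (1 / 4))\<^sup>2 < c\<^sup>2"
      using assms(3) pos by (intro power_strict_mono) auto
    moreover have "(2 * (1 / 3 :: real) powr (1 / 4))\<^sup>2 = 4 / sqrt 3"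
      by (simp add: power_mult_distrib powr_power powr_half_sqrt real_sqrt_divide)
    ultimately have "4 / sqrt 3 < c\<^sup>2" by (simp only:)
    then have c2: "4 * (1 / sqrt 3) < c\<^sup>2" "sqrt 3 + 1 / sqrt 3 < c\<^sup>2"
      by (simp_all add: field_simps)
    have vec: "(\<lambda>n. vector [i n / (2 * s n), j n / (2 * r n)] :: real^2) \<longlonglongrightarrow> y"
    proof (rule vec_tendstoI)
      have "\<forall>k. (\<lambda>n. (vector [i n / (2 * s n), j n / (2 * r n)] :: real^2) $ k) \<longlonglongrightarrow> y $ k"
        using lim by (simp add: forall_2)
      then show "(\<lambda>n. (vector [i n / (2 * s n), j n / (2 * r n)] :: real^2) $ k) \<longlonglongrightarrow> y $ k" for k by blast
    qed
    have "\<forall>\<^sub>F n in sequentially. 4 * (r n / s n) < c\<^sup>2 \<and> s n / r n + r n / s n < c\<^sup>2 \<and>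
        vector [i n / (2 * s n), j n / (2 * r n)] \<in> U"
      using order_tendstoD(2)[OF tendsto_mult[OF tendsto_const inv] c2(1)]
        order_tendstoD(2)[OF tendsto_add[OF lim(1) inv] c2(2)]
        topological_tendstoD[OF vec assms(1) \<open>y \<in> U\<close>]
      by eventually_elim simp
    then obtain n where "4 * (r n / s n) < c\<^sup>2" "s n / r n + r n / s n < c\<^sup>2"
        "vector [i n / (2 * s n), j n / (2 * r n)] \<in> U"
      by (auto simp: eventually_sequentially)
    moreover have "c > 0" using assms(3) pos by linarith
    ultimately show ?thesis
      using small_triangles_at_lattice_point[OF *(1-5) assms(1)] by blast
  qed
qed

section \<open>Rank 3 points and category\<close>

text \<open>Too many vectors are dependent over the rationals, and multiplying the relation by a
  common denominator makes it integral.\<close>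

lemma integer_vectors_dependent:
  fixes f :: "'a \<Rightarrow> int^'n"
  assumes "finite B" "card B > CARD('n)"
  shows "\<exists>c :: 'a \<Rightarrow> int. (\<exists>b\<in>B. c b \<noteq> 0) \<and> (\<forall>k. (\<Sum>b\<in>B. c b * f b $ k) = 0)"
proof (cases "inj_on f B")
  \<comment> \<open>Linear dependence is a property of the image set, so a repeated vector is
    treated apart, with coefficients 1 and -1.\<close>
  case False
  then obtain x y where xy: "x \<in> B" "y \<in> B" "x \<noteq> y" "f x = f y"
    by (auto simp: inj_on_def)
  define c :: "'a \<Rightarrow> int" where "c b = (if b = x then 1 else if b = y then -1 else 0)" for b
  have "(\<Sum>b\<in>B. c b * f b $ k) = (\<Sum>b\<in>{x, y}. c b * f b $ k)" for k
    using assms xy by (intro sum.mono_neutral_right) (auto simp: c_def)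
  then have "\<forall>k. (\<Sum>b\<in>B. c b * f b $ k) = 0"
    using xy by (simp add: c_def)
  moreover have "c x \<noteq> 0" by (simp add: c_def)
  ultimately show ?thesis using xy by blast
next
  case True
  define g :: "'a \<Rightarrow> rat^'n" where "g b = (\<chi> k. of_int (f b $ k))" for b
  have "inj_on g B"
    using True by (auto simp: inj_on_def g_def vec_eq_iff)
  then have card: "card (g ` B) > CARD('n)"
    using assms by (simp add: card_image)
  have "vec.dependent (g ` B)"
  proof (rule ccontr)
    assume "\<not> vec.dependent (g ` B)"
    then have "card (g ` B) \<le> vec.dim (UNIV :: (rat^'n) set)"
      by (intro vec.independent_card_le_dim) auto
    then show False using card by (simp only: vec_dim_card)
  qed
  then obtain u where u: "\<exists>v\<in>g ` B. u v \<noteq> 0" "(\<Sum>v\<in>g ` B. u v *s v) = 0"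
    using vec.dependent_finite[of "g ` B"] assms by auto
  define w where "w b = u (g b)" for b
  have w: "(\<Sum>b\<in>B. w b *s g b) = 0"
    using u(2) by (simp add: sum.reindex[OF \<open>inj_on g B\<close>] w_def)
  define d where "d b = snd (quotient_of (w b))" for b
  have d_pos: "d b > 0" for b
    by (simp add: d_def quotient_of_denom_pos')
  define D where "D = (\<Prod>b\<in>B. d b)"
  have D_pos: "D > 0" unfolding D_def by (intro prod_pos) (simp add: d_pos)
  have "\<exists>m :: int. of_int m = of_int D * w b" if bB: "b \<in> B" for b
  proof -
    have "w b = of_int (fst (quotient_of (w b))) / of_int (d b)"
      by (simp add: d_def quotient_of_div)
    moreover obtain e where "D = d b * e"
      using dvd_prodI[OF assms(1) bB, of d] by (auto simp: D_def dvd_def)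
    ultimately have "of_int D * w b = of_int (e * fst (quotient_of (w b)))"
      using d_pos[of b] by (simp add: field_simps)
    then show ?thesis by metis
  qed
  then obtain c :: "'a \<Rightarrow> int" where c: "\<And>b. b \<in> B \<Longrightarrow> of_int (c b) = of_int D * w b"
    by metis
  have "(\<Sum>b\<in>B. c b * f b $ k) = 0" for k
  proof -
    have "of_int (\<Sum>b\<in>B. c b * f b $ k) = (\<Sum>b\<in>B. of_int D * (w b * of_int (f b $ k)) :: rat)"
      by (simp add: c mult.assoc)
    also have "\<dots> = of_int D * ((\<Sum>b\<in>B. w b *s g b) $ k)"
      by (simp add: sum_distrib_left g_def)
    finally have "of_int (\<Sum>b\<in>B. c b * f b $ k) = (0 :: rat)"
      by (simp add: w)
    then show ?thesis by (simp only: of_int_eq_0_iff)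
  qed
  moreover obtain b where "b \<in> B" "w b \<noteq> 0"
    using u(1) by (auto simp: w_def)
  then have "of_int (c b) \<noteq> (0 :: rat)"
    using c D_pos by simp
  then have "c b \<noteq> 0" by simp
  ultimately show ?thesis using \<open>b \<in> B\<close> by blast
qed

lemma rank3_pointI:
  fixes x :: "real^2"
  assumes indep: "\<And>a b c :: int. of_int a * x $ 1 + of_int b * x $ 2 + of_int c = 0 \<Longrightarrow> a = 0 \<and> b = 0 \<and> c = 0"
  shows "rank3_point x"
  unfolding rank3_point_def has_rank_def
proof (intro conjI allI impI)
  let ?G = "{of_int a * x $ 1 + of_int b * x $ 2 + of_int c | a b c :: int. True}"
  have ne: "x $ 1 \<noteq> x $ 2" "x $ 1 \<noteq> 1" "x $ 2 \<noteq> 1"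
    using indep[of 1 "-1" 0] indep[of 1 0 "-1"] indep[of 0 1 "-1"] by auto
  have "int_independent {x $ 1, x $ 2, 1}"
    unfolding int_independent_def using ne indep by (auto simp: add.assoc)
  moreover define G where "G = ?G"
  have "of_int a * x $ 1 + of_int b * x $ 2 + of_int c \<in> G" for a b c
    unfolding G_def by blast
  from this[of 1 0 0] this[of 0 1 0] this[of 0 0 1] have "{x $ 1, x $ 2, 1} \<subseteq> G"
    by simp
  moreover have "card {x $ 1, x $ 2, 1} = 3"
    using ne by simp
  ultimately show "\<exists>B\<subseteq>?G. int_independent B \<and> card B = 3"
    unfolding G_def by blast
next
  let ?G = "{of_int a * x $ 1 + of_int b * x $ 2 + of_int c | a b c :: int. True}"
  fix B assume B: "B \<subseteq> ?G" "int_independent B"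
  \<comment> \<open>Coefficient vectors in three integer coordinates: a relation among four or more
    of them passes to the elements of \<open>B\<close>, which bounds the rank from above.\<close>
  have "\<forall>b\<in>B. \<exists>v :: int^3. b = of_int (v $ 1) * x $ 1 + of_int (v $ 2) * x $ 2 + of_int (v $ 3)"
  proof
    fix b assume "b \<in> B"
    then obtain m n k :: int where "b = of_int m * x $ 1 + of_int n * x $ 2 + of_int k"
      using B(1) by blast
    then show "\<exists>v :: int^3. b = of_int (v $ 1) * x $ 1 + of_int (v $ 2) * x $ 2 + of_int (v $ 3)"
      by (intro exI[of _ "vector [m, n, k]"]) simp
  qed
  then obtain f :: "real \<Rightarrow> int^3" where
    f: "\<And>b. b \<in> B \<Longrightarrow> b = of_int (f b $ 1) * x $ 1 + of_int (f b $ 2) * x $ 2 + of_int (f b $ 3)"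
    by metis
  show "card B \<le> 3"
  proof (rule ccontr)
    assume "\<not> card B \<le> 3"
    moreover have fin: "finite B" using B by (simp add: int_independent_def)
    ultimately obtain c :: "real \<Rightarrow> int" where c: "\<exists>b\<in>B. c b \<noteq> 0" "\<And>k. (\<Sum>b\<in>B. c b * f b $ k) = 0"
      using integer_vectors_dependent[of B f] by auto
    have "(\<Sum>b\<in>B. of_int (c b) * b) = (\<Sum>b\<in>B. of_int (c b * f b $ 1) * x $ 1 + of_int (c b * f b $ 2) * x $ 2 + of_int (c b * f b $ 3))"
      by (rule sum.cong[OF refl], subst f) (auto simp: algebra_simps)
    also have "\<dots> = of_int (\<Sum>b\<in>B. c b * f b $ 1) * x $ 1 + of_int (\<Sum>b\<in>B. c b * f b $ 2) * x $ 2 + of_int (\<Sum>b\<in>B. c b * f b $ 3)"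
      by (simp only: sum.distrib of_int_sum sum_distrib_right)
    also have "\<dots> = 0" by (simp add: c(2) del: of_int_sum)
    finally show False
      using B(2) c(1) by (auto simp: int_independent_def)
  qed
qed

section \<open>Baire category and the dense set of good points\<close>

lemma interior_unimodular_triangle_nonempty:
  assumes "unimodular_triangle M T"
  shows "interior T \<noteq> {}"
proof
  assume "interior T = {}"
  moreover have "convex T"
    using assms by (auto simp: unimodular_triangle_def)
  moreover have "bounded T"
    using assms by (rule bounded_unimodular_triangle)
  ultimately have "measure lebesgue T = 0"
    using negligible_convex_interior negligible_imp_measure0 by blast
  moreover have "measure lebesgue T > 0"
    using unimodular_measure[OF assms] assms by (simp add: unimodular_triangle_def)
  ultimately show False by simp
qed

text \<open>Interiors make the set open, as Baire's theorem requires; the bound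
  \<open>1 / Suc n\<close> makes the triangles shrink.\<close>

definition near_equilateral_core :: "real \<Rightarrow> nat \<Rightarrow> (real^2) set" where
  "near_equilateral_core c n = \<Union> {interior T | M T. unimodular_triangle M T \<and>
     diameter T < c * sqrt (measure lebesgue T) \<and> diameter T < 1 / Suc n}"

text \<open>For \<open>a = b = 0\<close> this is no line: it is empty if \<open>c\<close> is
  nonzero, and the whole plane for the zero triple, which is excluded below.\<close>

definition rational_line :: "int \<times> int \<times> int \<Rightarrow> (real^2) set" where
  "rational_line = (\<lambda>(a, b, c). {x. of_int a * x $ 1 + of_int b * x $ 2 + of_int c = 0})"

lemma near_equilateral_core_dense:
  assumes "2 * (1 / 3) powr (1 / 4) < c"
  shows "closure (near_equilateral_core c n) = UNIV"
proof -
  have "\<exists>y \<in> near_equilateral_core c n. dist y x < e" if "e > 0" for x e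
  proof -
    define h where "h = 1 / real (Suc n)"
    \<comment> \<open>A triangle in a ball of radius \<open>h / 3\<close> has diameter at most
      \<open>2 * h / 3\<close>, strictly below the required \<open>h\<close>.\<close>
    define e' where "e' = min e (h / 3)"
    have "h > 0" by (simp add: h_def)
    then have e': "e' > 0" "e' \<le> e" "2 * e' < h"
      using that by (auto simp: e'_def min_def)
    obtain M T where T: "unimodular_triangle M T" "T \<subseteq> ball x e'" "diameter T < c * sqrt (measure lebesgue T)"
      using nearly_equilateral_triangles_dense[of "ball x e'" c] assms e' by auto
    have "diameter T \<le> 2 * e'"
      using diameter_subset[OF T(2)] e' by simp
    then have "interior T \<subseteq> near_equilateral_core c n"
      using T e' unfolding near_equilateral_core_def h_def by (intro Union_upper) fastforce
    moreover obtain y where "y \<in> interior T"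
      using interior_unimodular_triangle_nonempty[OF T(1)] by blast
    moreover have "y \<in> ball x e'"
      using \<open>y \<in> interior T\<close> T(2) interior_subset by blast
    ultimately show ?thesis using e' by (intro bexI[of _ y]) (auto simp: dist_commute)
  qed
  then show ?thesis by (auto simp: closure_approachable)
qed

lemma rational_line_complement:
  assumes "k \<noteq> (0, 0, 0)"
  shows "open (- rational_line k)" "closure (- rational_line k) = UNIV"
proof -
  obtain a b c where k: "k = (a, b, c)" by (cases k)
  have "closed (rational_line k)"
    unfolding rational_line_def k
    by (auto intro!: closed_Collect_eq continuous_intros)
  then show "open (- rational_line k)" by auto
  have "interior (rational_line k) = {}"
  proof (cases "a = 0 \<and> b = 0")
    case True
    then show ?thesis using assms by (simp add: rational_line_def k)
  next
    case False
    then have "(vector [of_int a, of_int b] :: real^2) \<noteq> 0"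
      by (auto simp: vec_eq_iff forall_2)
    then have "interior {x. (vector [of_int a, of_int b] :: real^2) \<bullet> x = - of_int c} = {}"
      by (rule interior_hyperplane)
    moreover have "rational_line k = {x. (vector [of_int a, of_int b] :: real^2) \<bullet> x = - of_int c}"
      by (auto simp: rational_line_def k inner_vec_def sum_2)
    ultimately show ?thesis by simp
  qed
  then show "closure (- rational_line k) = UNIV"
    by (simp add: closure_complement)
qed

text \<open>A countable intersection of open sets. Avoiding all rational lines expresses the integer
  independence of the two coordinates and 1.\<close>

definition good_points :: "real \<Rightarrow> (real^2) set" where
  "good_points c = (\<Inter>n. near_equilateral_core c n) \<inter> (\<Inter>k\<in>- {(0, 0, 0)}. - rational_line k)"

lemma good_points_dense:
  assumes "2 * (1 / 3) powr (1 / 4) < c"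
  shows "closure (good_points c) = UNIV"
proof -
  let ?G = "range (near_equilateral_core c) \<union> (\<lambda>k. - rational_line k) ` (- {(0, 0, 0)})"
  have open_core: "open (near_equilateral_core c n)" for n
    unfolding near_equilateral_core_def by (intro open_Union) auto
  have "UNIV \<subseteq> closure (\<Inter>?G)"
  proof (rule Baire)
    show "countable ?G" by auto
    show "openin (top_of_set UNIV) T \<and> UNIV \<subseteq> closure T" if "T \<in> ?G" for T
      using that open_core near_equilateral_core_dense[OF assms] rational_line_complement
      by (elim UnE imageE) simp_all
  qed auto
  moreover have "\<Inter>?G = good_points c" by (simp only: good_points_def Inter_Un_distrib)
  ultimately show ?thesis by auto
qed

lemma good_points_rank3:
  assumes "x \<in> good_points c"
  shows "rank3_point x"
  using assms by (intro rank3_pointI) (auto simp: good_points_def rational_line_def)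

section \<open>The expansion\<close>

text \<open>The raw triangles have bounded ratios that may oscillate; passing to a subsequence gives
  limits and still shrinks to \<open>x\<close>. The strict bound by \<open>c\<close> survives only
  as a weak one.\<close>

lemma convergent_good_triangles:
  assumes "x \<in> good_points c"
  obtains T L1 L2 where "\<And>n. \<exists>M. unimodular_triangle M (T n)" "\<And>n. x \<in> T n" "(\<lambda>n. diameter (T n)) \<longlonglongrightarrow> 0"
    "(\<lambda>n. (SUP y\<in>T n. dist x y) / sqrt (measure lebesgue (T n))) \<longlonglongrightarrow> L1"
    "(\<lambda>n. diameter (T n) / sqrt (measure lebesgue (T n))) \<longlonglongrightarrow> L2" "L1 \<le> L2" "L2 \<le> c"
proof -
  have "\<forall>n. \<exists>T. (\<exists>M. unimodular_triangle M T) \<and> x \<in> T \<and> diameter T < c * sqrt (measure lebesgue T) \<and>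
      diameter T < 1 / Suc n"
  proof
    fix n
    have "x \<in> near_equilateral_core c n"
      using assms by (simp add: good_points_def)
    then obtain M T where "unimodular_triangle M T" "x \<in> interior T"
      "diameter T < c * sqrt (measure lebesgue T)" "diameter T < 1 / Suc n"
      unfolding near_equilateral_core_def by blast
    then show "\<exists>T. (\<exists>M. unimodular_triangle M T) \<and> x \<in> T \<and> diameter T < c * sqrt (measure lebesgue T) \<and>
      diameter T < 1 / Suc n"
      using interior_subset by blast
  qed
  then obtain T where T: "\<And>n. \<exists>M. unimodular_triangle M (T n)" "\<And>n. x \<in> T n"
    "\<And>n. diameter (T n) < c * sqrt (measure lebesgue (T n))" "\<And>n. diameter (T n) < 1 / Suc n"
    by metis
  define far where "far n = (SUP y\<in>T n. dist x y)" for n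
  define A where "A n = sqrt (measure lebesgue (T n))" for n
  have A_pos: "A n > 0" for n
  proof -
    obtain M where "unimodular_triangle M (T n)" using T(1) by blast
    then show ?thesis
      using unimodular_measure[of M "T n"] by (simp add: A_def unimodular_triangle_def)
  qed
  have bdd: "bounded (T n)" for n
    using T(1) bounded_unimodular_triangle by blast
  have far: "0 \<le> far n" "far n \<le> diameter (T n)" for n
  proof -
    have d: "dist x y \<le> diameter (T n)" if "y \<in> T n" for y
      using diameter_bounded_bound[OF bdd T(2) that] .
    then show "far n \<le> diameter (T n)"
      unfolding far_def using T(2) by (intro cSUP_least) auto
    have "bdd_above (dist x ` T n)"
      using d by (auto simp: bdd_above_def)
    then have "dist x x \<le> far n"
      unfolding far_def using T(2) by (intro cSUP_upper)
    then show "0 \<le> far n" by simp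
  qed
  \<comment> \<open>Pairing the ratios yields one subsequence along which both converge, by
    compactness of the square.\<close>
  define f where "f n = (far n / A n, diameter (T n) / A n)" for n
  have "f n \<in> {0..c} \<times> {0..c}" for n
    using far[of n] A_pos[of n] T(3)[of n] diameter_ge_0[OF bdd, of n]
    by (auto simp: f_def A_def[symmetric] pos_divide_le_eq)
  moreover have "compact ({0..c} \<times> {0..c})"
    by (intro compact_Times compact_Icc)
  ultimately obtain L r where L: "strict_mono r" "(f \<circ> r) \<longlonglongrightarrow> L" "L \<in> {0..c} \<times> {0..c}"
    unfolding compact_def by metis
  have l1: "(\<lambda>n. far (r n) / A (r n)) \<longlonglongrightarrow> fst L" and l2: "(\<lambda>n. diameter (T (r n)) / A (r n)) \<longlonglongrightarrow> snd L"
    using tendsto_fst[OF L(2)] tendsto_snd[OF L(2)] by (simp_all add: f_def o_def)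
  have "far (r n) / A (r n) \<le> diameter (T (r n)) / A (r n)" for n
    using far A_pos by (intro divide_right_mono) (simp_all add: less_imp_le)
  then have "fst L \<le> snd L"
    using LIMSEQ_le[OF l1 l2] by blast
  moreover have "snd L \<le> c" using L(3) by auto
  moreover have "(\<lambda>n. diameter (T n)) \<longlonglongrightarrow> 0"
  proof (rule tendsto_sandwich[OF _ _ tendsto_const LIMSEQ_inverse_real_of_nat])
    show "\<forall>\<^sub>F n in sequentially. 0 \<le> diameter (T n)"
      using diameter_ge_0[OF bdd] by simp
    show "\<forall>\<^sub>F n in sequentially. diameter (T n) \<le> inverse (real (Suc n))"
      using T(4) by (intro always_eventually allI) (simp add: less_imp_le inverse_eq_divide del: of_nat_Suc)
  qed
  then have "(\<lambda>n. diameter (T (r n))) \<longlonglongrightarrow> 0"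
    using LIMSEQ_subseq_LIMSEQ[OF _ L(1)] by (auto simp: o_def)
  ultimately show ?thesis
    using that[of "\<lambda>n. T (r n)" "fst L" "snd L"] T(1,2) l1 l2 by (simp add: far_def A_def)
qed

text \<open>Serves the points outside \<open>good_points c\<close>, where the triangles only have to
  contract to \<open>x\<close>.\<close>

lemma shrinking_triangles:
  obtains T where "\<And>n :: nat. \<exists>M. unimodular_triangle M (T n)" "\<And>n. x \<in> T n" "(\<lambda>n. diameter (T n)) \<longlonglongrightarrow> 0"
proof -
  have "\<forall>n :: nat. \<exists>T. (\<exists>M. unimodular_triangle M T) \<and> x \<in> T \<and> T \<subseteq> ball x (inverse (Suc n))"
    using exists_small_unimodular_triangle[of "inverse (Suc _)" x] by (metis inverse_positive_iff_positive of_nat_0_less_iff zero_less_Suc)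
  then obtain T where T: "\<And>n. \<exists>M. unimodular_triangle M (T n)" "\<And>n :: nat. x \<in> T n"
    "\<And>n. T n \<subseteq> ball x (inverse (Suc n))"
    by metis
  have "(\<lambda>n. diameter (T n)) \<longlonglongrightarrow> 0"
  proof (rule tendsto_sandwich[OF _ _ tendsto_const])
    show "\<forall>\<^sub>F n in sequentially. 0 \<le> diameter (T n)"
      using T(1) bounded_unimodular_triangle diameter_ge_0 by (intro always_eventually) blast
    show "\<forall>\<^sub>F n in sequentially. diameter (T n) \<le> 2 * inverse (real (Suc n))"
      using diameter_subset[OF T(3)] by (intro always_eventually allI) (simp del: of_nat_Suc)
    show "(\<lambda>n. 2 * inverse (real (Suc n))) \<longlonglongrightarrow> 0"
      using tendsto_mult[OF tendsto_const LIMSEQ_inverse_real_of_nat, of 2] by simp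
  qed
  then show ?thesis using that T(1,2) by blast
qed

lemma Inter_eq_singleton:
  assumes "\<And>n :: nat. bounded (T n)" "\<And>n. x \<in> T n" "(\<lambda>n. diameter (T n)) \<longlonglongrightarrow> 0"
  shows "(\<Inter>n. T n) = {x}"
proof -
  have "y = x" if "\<And>n. y \<in> T n" for y
  proof -
    have "dist y x \<le> diameter (T n)" for n
      using diameter_bounded_bound[OF assms(1) that assms(2)] .
    then have "dist y x \<le> 0"
      by (intro LIMSEQ_le_const[OF assms(3)]) auto
    then show ?thesis by simp
  qed
  then show ?thesis using assms(2) by blast
qed

theorem theorem1p2:
  fixes \<epsilon> :: real
  assumes "\<epsilon> > 0"
  shows "\<exists>\<mu>. continued_fraction_expansion \<mu> \<and>
    (\<exists>X :: (real^2) set. closure X = UNIV \<and> (\<forall>x\<in>X. rank3_point x) \<and>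
      (\<forall>x\<in>X. \<forall>M :: nat \<Rightarrow> int^3^3. (\<forall>n. unimodular_triangle (M n) (\<mu> x n)) \<longrightarrow>
        (\<exists>L1 L2 :: real.
          (\<lambda>n. (MAX i\<in>UNIV. dist x (rat_point (M n $ i))) /
               (2 * real_of_int (M n $ 1 $ 3) * real_of_int (M n $ 2 $ 3) *
                  real_of_int (M n $ 3 $ 3)) powr (- 1 / 2)) \<longlonglongrightarrow> L1 \<and>
          (\<lambda>n. longest_side (M n) / measure lebesgue (\<mu> x n) powr (1 / 2)) \<longlonglongrightarrow> L2 \<and>
          L1 \<le> L2 \<and> L2 < 2 * (1 / 3) powr (1 / 4) + \<epsilon>)))"
proof -
  \<comment> \<open>Half of \<epsilon> leaves room on both sides: \<open>c\<close> exceeds the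
    equilateral value, and a limit at most \<open>c\<close> is still strictly below the claimed
    bound.\<close>
  define c where "c = 2 * (1 / 3) powr (1 / 4) + \<epsilon> / 2"
  have c: "2 * (1 / 3) powr (1 / 4) < c" "c < 2 * (1 / 3) powr (1 / 4) + \<epsilon>"
    using assms by (simp_all add: c_def)
  let ?ratios = "\<lambda>x T. \<exists>L1 L2. (\<lambda>n. (SUP y\<in>T n. dist x y) / sqrt (measure lebesgue (T n))) \<longlonglongrightarrow> L1 \<and>
    (\<lambda>n. diameter (T n) / sqrt (measure lebesgue (T n))) \<longlonglongrightarrow> L2 \<and> L1 \<le> L2 \<and> L2 \<le> c"
  \<comment> \<open>All requirements on the sequence at \<open>x\<close> are collected in one
    predicate, so that the expansion arises from a pointwise choice.\<close>
  define P where "P x T \<longleftrightarrow> (\<forall>n. \<exists>M. unimodular_triangle M (T n)) \<and> (\<forall>n :: nat. x \<in> T n) \<and>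
    (\<lambda>n. diameter (T n)) \<longlonglongrightarrow> 0 \<and> (x \<in> good_points c \<longrightarrow> ?ratios x T)" for x T
  have "\<exists>T. P x T" for x
  proof (cases "x \<in> good_points c")
    case True
    then show ?thesis unfolding P_def by (rule convergent_good_triangles) blast
  next
    case False
    then show ?thesis unfolding P_def using shrinking_triangles[of x] by metis
  qed
  then obtain \<mu> where "\<And>x. P x (\<mu> x)"
    by metis
  then have \<mu>: "\<And>x n. \<exists>M. unimodular_triangle M (\<mu> x n)" "\<And>x n. x \<in> \<mu> x n"
    "\<And>x. (\<lambda>n. diameter (\<mu> x n)) \<longlonglongrightarrow> 0" "\<And>x. x \<in> good_points c \<Longrightarrow> ?ratios x (\<mu> x)"
    unfolding P_def by blast+
  have "(\<Inter>n. \<mu> x n) = {x}" for x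
    using \<mu>(1-3) bounded_unimodular_triangle by (intro Inter_eq_singleton) blast+
  then have "continued_fraction_expansion \<mu>"
    using \<mu>(1) by (simp add: continued_fraction_expansion_def)
  moreover have "\<exists>L1 L2 :: real.
          (\<lambda>n. (MAX i\<in>UNIV. dist x (rat_point (M n $ i))) /
               (2 * real_of_int (M n $ 1 $ 3) * real_of_int (M n $ 2 $ 3) *
                  real_of_int (M n $ 3 $ 3)) powr (- 1 / 2)) \<longlonglongrightarrow> L1 \<and>
          (\<lambda>n. longest_side (M n) / measure lebesgue (\<mu> x n) powr (1 / 2)) \<longlonglongrightarrow> L2 \<and>
          L1 \<le> L2 \<and> L2 < 2 * (1 / 3) powr (1 / 4) + \<epsilon>"
    if x: "x \<in> good_points c" and M: "\<And>n. unimodular_triangle (M n) (\<mu> x n)" for x M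
  proof -
    \<comment> \<open>The matrices are arbitrary here, but both ratios turn into expressions in the
      sets \<open>\<mu> x n\<close>, whose limits were fixed when \<mu> was chosen.\<close>
    have T: "convex hull (range (\<lambda>i. rat_point (M n $ i))) = \<mu> x n" for n
      using M[of n] by (simp add: unimodular_triangle_def)
    have area: "measure lebesgue (\<mu> x n) powr (1 / 2) = sqrt (measure lebesgue (\<mu> x n))" for n
      by (simp add: powr_half_sqrt)
    have d: "(2 * real_of_int (M n $ 1 $ 3) * real_of_int (M n $ 2 $ 3) * real_of_int (M n $ 3 $ 3)) powr (- 1 / 2)
        = sqrt (measure lebesgue (\<mu> x n))" (is "?d powr _ = _") for n
    proof -
      have "?d > 0"
        using M[of n] by (simp add: unimodular_triangle_def)
      then show ?thesis
        by (simp add: unimodular_measure[OF M] powr_minus powr_half_sqrt real_sqrt_divide inverse_eq_divide)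
    qed
    show ?thesis
      unfolding d area MAX_dist_convex_hull longest_side_eq_diameter T
      using \<mu>(4)[OF x] c(2) by force
  qed
  ultimately show ?thesis
    using good_points_dense[OF c(1)] good_points_rank3 by blast
qed

end
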